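(* Let $(M,g)$ be the interior black hole (IBH) spacetime with metric $$g=-\Big(\tfrac{2\xi}{t}-1\Big)^{-1}dt^2+\Big(\tfrac{2\xi}{t}-1\Big)dz^2+t^2\big(d\theta^2+\sin^2\theta\, d\phi^2\big),$$ where $\xi=\xi(t)$ is a smooth function. Put $$V_1=\xi-t\dot\xi,\qquad V_5=t^2\ddot\xi-4t\dot\xi+6\xi,\qquad E=3\xi^2-t^2\dot\xi^2+2t\xi\,(t\ddot\xi-\dot\xi),$$ and assume $V_5\neq 0$ and $E\neq 0$ everywhere. Then the following identities hold on $M$: (i) $R\cdot R-Q(S,R)=L_1\,Q(g,C)$, where $L_1=\dfrac{2\,(3\xi^2-2t\xi\dot\xi-t^2\dot\xi^2+2t^2\xi\ddot\xi)}{t^3V_5}$; (ii) $C\cdot R-R\cdot C=L_2\,Q(g,R)+L_3\,Q(S,R)$, where $L_2=\dfrac{(2\dot\xi V_1+t\xi\ddot\xi)\,V_5}{3t^2E}$ and $L_3=\dfrac{V_1V_5}{2E}$; (iii) $C\cdot R-R\cdot C=L_4\,Q(g,C)+L_5\,Q(S,C)$, where $L_4=\dfrac{2(2\dot\xi+t\ddot\xi)}{3t^2}$ and $L_5=1$.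
   Context: Coordinates are $(x^1,x^2,x^3,x^4)=(t,z,\theta,\phi)$ with $t>0$ in an open interval, $0<\theta<\pi$, and $t\neq 2\xi(t)$; dots denote $d/dt$. Curvature sign conventions (the ones matching the components used for this spacetime): $\mathcal R(X,Y)Z=\nabla_{[X,Y]}Z-\nabla_X\nabla_YZ+\nabla_Y\nabla_XZ$ with $\nabla$ the Levi-Civita connection, $R(X_1,X_2,X_3,X_4)=g(\mathcal R(X_1,X_2)X_3,X_4)$, Ricci tensor $S_{jk}=g^{il}R_{ijkl}$, scalar curvature $\kappa=g^{jk}S_{jk}$. With these conventions the nonzero components (up to symmetries) are $R_{1212}=-\frac{t^2\ddot\xi-2t\dot\xi+2\xi}{t^3}$, $R_{1313}=-\frac{\xi-t\dot\xi}{t-2\xi}$, $R_{1414}=\sin^2\theta\, R_{1313}$, $R_{2323}=\frac{(t-2\xi)(\xi-t\dot\xi)}{t^2}$, $R_{2424}=\sin^2\theta\, R_{2323}$, $R_{3434}=2t\xi\sin^2\theta$; moreover $S_{11}=-\frac{\ddot\xi}{t}g_{11}$, $S_{22}=-\frac{\ddot\xi}{t}g_{22}$, $S_{33}=-\frac{2\dot\xi}{t^2}g_{33}$, $S_{44}=-\frac{2\dot\xi}{t^2}g_{44}$, and $\kappa=-\frac{2(2\dot\xi+t\ddot\xi)}{t^2}$. For symmetric $(0,2)$-tensors $H,F$ the Kulkarni–Nomizu product is $(H\wedge F)_{cdef}=H_{cf}F_{de}+H_{de}F_{cf}-H_{ce}F_{df}-H_{df}F_{ce}$. The conformal curvature tensor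 (dimension 4) is $C=R-\frac12\, g\wedge S+\frac{\kappa}{12}\, g\wedge g$. For a $(0,4)$ curvature-type tensor $A$, let $\mathcal A(X,Y)Z$ be defined by $g(\mathcal A(X,Y)Z,W)=A(X,Y,Z,W)$. For a $(0,l)$-tensor $U$, $$(A\cdot U)(X_1,\dots,X_l;X,Y)=-\sum_{i=1}^{l}U(X_1,\dots,\mathcal A(X,Y)X_i,\dots,X_l),$$ and for a symmetric $(0,2)$-tensor $B$, $$Q(B,U)(X_1,\dots,X_l;X,Y)=\sum_{i=1}^{l}\big[B(X,X_i)\,U(X_1,\dots,Y,\dots,X_l)-B(Y,X_i)\,U(X_1,\dots,X,\dots,X_l)\big],$$ with $Y$ (resp. $X$) inserted in the $i$-th slot. *)

theory Defs
  imports "HOL-Analysis.Analysis"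
begin

text \<open>
  A metric on a coordinate chart is its matrix of components in the coordinate frame, as a
  function of the point, and a vector field is its column of components. Tensors at a point are
  multilinear functions of tangent vectors.
\<close>

type_synonym 'n metric_field = "real^'n \<Rightarrow> real^'n^'n"
type_synonym 'n vector_field = "real^'n \<Rightarrow> real^'n"
type_synonym 'n tensor2 = "real^'n \<Rightarrow> real^'n \<Rightarrow> real"
type_synonym 'n tensor4 = "real^'n \<Rightarrow> real^'n \<Rightarrow> real^'n \<Rightarrow> real^'n \<Rightarrow> real"
type_synonym 'n tensor6 = "real^'n \<Rightarrow> real^'n \<Rightarrow> real^'n \<Rightarrow> real^'n \<Rightarrow> real^'n \<Rightarrow> real^'n \<Rightarrow> real"

definition metric_form :: "'n::finite metric_field \<Rightarrow> real^'n \<Rightarrow> 'n tensor2" where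
  "metric_form g p X Y = (\<Sum>i\<in>UNIV. \<Sum>j\<in>UNIV. g p $ i $ j * X $ i * Y $ j)"

definition partial :: "'n::finite \<Rightarrow> (real^'n \<Rightarrow> real) \<Rightarrow> real^'n \<Rightarrow> real" where
  "partial i f p = frechet_derivative f (at p) (axis i 1)"

text \<open>Argument order of the Christoffel symbol: \<open>\<Gamma> i j k\<close> has lower indices \<open>i, j\<close> and upper index \<open>k\<close>.\<close>

definition christoffel :: "'n::finite metric_field \<Rightarrow> real^'n \<Rightarrow> 'n \<Rightarrow> 'n \<Rightarrow> 'n \<Rightarrow> real" where
  "christoffel g p i j k = (1/2) * (\<Sum>l\<in>UNIV. matrix_inv (g p) $ k $ l *
     (partial i (\<lambda>q. g q $ j $ l) p + partial j (\<lambda>q. g q $ i $ l) p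
      - partial l (\<lambda>q. g q $ i $ j) p))"

definition levi_civita ::
    "'n::finite metric_field \<Rightarrow> 'n vector_field \<Rightarrow> 'n vector_field \<Rightarrow> 'n vector_field" where
  "levi_civita g X Y p = frechet_derivative Y (at p) (X p)
     + (\<chi> k. \<Sum>i\<in>UNIV. \<Sum>j\<in>UNIV. christoffel g p i j k * X p $ i * Y p $ j)"

definition lie_bracket ::
    "'n::finite vector_field \<Rightarrow> 'n vector_field \<Rightarrow> 'n vector_field" where
  "lie_bracket X Y p = frechet_derivative Y (at p) (X p) - frechet_derivative X (at p) (Y p)"

text \<open>
  The sign is opposite to the more common
  \<open>\<nabla>\<^sub>X \<nabla>\<^sub>Y Z - \<nabla>\<^sub>Y \<nabla>\<^sub>X Z - \<nabla>\<^bsub>[X,Y]\<^esub> Z\<close>.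
\<close>

definition curvature_op ::
    "'n::finite metric_field \<Rightarrow> 'n vector_field \<Rightarrow> 'n vector_field \<Rightarrow> 'n vector_field
      \<Rightarrow> 'n vector_field" where
  "curvature_op g X Y Z p = levi_civita g (lie_bracket X Y) Z p
     - levi_civita g X (levi_civita g Y Z) p + levi_civita g Y (levi_civita g X Z) p"

text \<open>
  The value at \<open>p\<close> of the curvature on vector fields depends only on their values at \<open>p\<close>, so
  tangent vectors at \<open>p\<close> are extended by the vector fields with constant components.
\<close>

definition riemann :: "'n::finite metric_field \<Rightarrow> real^'n \<Rightarrow> 'n tensor4" where
  "riemann g p X1 X2 X3 X4 =
     metric_form g p (curvature_op g (\<lambda>_. X1) (\<lambda>_. X2) (\<lambda>_. X3) p) X4"

text \<open>The contraction is over the first and last slots of the curvature tensor.\<close>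

definition ricci :: "'n::finite metric_field \<Rightarrow> real^'n \<Rightarrow> 'n tensor2" where
  "ricci g p Y Z = (\<Sum>i\<in>UNIV. \<Sum>l\<in>UNIV.
     matrix_inv (g p) $ i $ l * riemann g p (axis i 1) Y Z (axis l 1))"

definition scalar_curvature :: "'n::finite metric_field \<Rightarrow> real^'n \<Rightarrow> real" where
  "scalar_curvature g p = (\<Sum>j\<in>UNIV. \<Sum>k\<in>UNIV.
     matrix_inv (g p) $ j $ k * ricci g p (axis j 1) (axis k 1))"

definition kulkarni_nomizu :: "'n::finite tensor2 \<Rightarrow> 'n tensor2 \<Rightarrow> 'n tensor4" where
  "kulkarni_nomizu H F X1 X2 X3 X4 =
     H X1 X4 * F X2 X3 + H X2 X3 * F X1 X4 - H X1 X3 * F X2 X4 - H X2 X4 * F X1 X3"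

text \<open>The coefficients \<open>1/2\<close> and \<open>1/12\<close> are those of dimension four.\<close>

definition conformal :: "4 metric_field \<Rightarrow> real^4 \<Rightarrow> 4 tensor4" where
  "conformal g p X1 X2 X3 X4 = riemann g p X1 X2 X3 X4
     - (1/2) * kulkarni_nomizu (metric_form g p) (ricci g p) X1 X2 X3 X4
     + scalar_curvature g p / 12
         * kulkarni_nomizu (metric_form g p) (metric_form g p) X1 X2 X3 X4"

definition assoc_op ::
    "'n::finite metric_field \<Rightarrow> real^'n \<Rightarrow> 'n tensor4 \<Rightarrow> real^'n \<Rightarrow> real^'n \<Rightarrow> real^'n \<Rightarrow> real^'n" where
  "assoc_op g p A X Y Z = (THE V. \<forall>W. metric_form g p V W = A X Y Z W)"

text \<open>The tensors \<open>A \<cdot> U\<close> and \<open>Q(B, U)\<close>, for \<open>U\<close> of type \<open>(0,4)\<close>.\<close>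

definition curv_dot ::
    "'n::finite metric_field \<Rightarrow> real^'n \<Rightarrow> 'n tensor4 \<Rightarrow> 'n tensor4 \<Rightarrow> 'n tensor6" where
  "curv_dot g p A U X1 X2 X3 X4 X Y =
     - (U (assoc_op g p A X Y X1) X2 X3 X4 + U X1 (assoc_op g p A X Y X2) X3 X4
        + U X1 X2 (assoc_op g p A X Y X3) X4 + U X1 X2 X3 (assoc_op g p A X Y X4))"

definition tachibana :: "'n::finite tensor2 \<Rightarrow> 'n tensor4 \<Rightarrow> 'n tensor6" where
  "tachibana B U X1 X2 X3 X4 X Y =
       (B X X1 * U Y X2 X3 X4 - B Y X1 * U X X2 X3 X4)
     + (B X X2 * U X1 Y X3 X4 - B Y X2 * U X1 X X3 X4)
     + (B X X3 * U X1 X2 Y X4 - B Y X3 * U X1 X2 X X4)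
     + (B X X4 * U X1 X2 X3 Y - B Y X4 * U X1 X2 X3 X)"

text \<open>Coordinates 1, 2, 3, 4 are \<open>t, z, \<theta>, \<phi>\<close>.\<close>

definition ibh_metric :: "(real \<Rightarrow> real) \<Rightarrow> 4 metric_field" where
  "ibh_metric \<xi> p = (\<chi> i j. if i \<noteq> j then 0
     else if i = 1 then - inverse (2 * \<xi> (p $ 1) / p $ 1 - 1)
     else if i = 2 then 2 * \<xi> (p $ 1) / p $ 1 - 1
     else if i = 3 then (p $ 1)\<^sup>2
     else (p $ 1)\<^sup>2 * (sin (p $ 3))\<^sup>2)"

text \<open>
  The angle \<open>\<phi>\<close> ranges over all reals: the components do not depend on it, so nothing changes
  locally when it is taken modulo \<open>2\<pi>\<close>.
\<close>

definition ibh_domain :: "(real \<Rightarrow> real) \<Rightarrow> real set \<Rightarrow> (real^4) set" where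
  "ibh_domain \<xi> I = {p. p $ 1 \<in> I \<and> p $ 1 \<noteq> 2 * \<xi> (p $ 1) \<and> 0 < p $ 3 \<and> p $ 3 < pi}"

text \<open>Only meaningful for open \<open>I\<close>, since \<open>deriv\<close> is the two-sided derivative.\<close>

definition smooth_on :: "real set \<Rightarrow> (real \<Rightarrow> real) \<Rightarrow> bool" where
  "smooth_on I f \<longleftrightarrow> (\<forall>n. (deriv ^^ n) f differentiable_on I)"

definition V1 :: "(real \<Rightarrow> real) \<Rightarrow> real \<Rightarrow> real" where
  "V1 \<xi> t = \<xi> t - t * deriv \<xi> t"

definition V5 :: "(real \<Rightarrow> real) \<Rightarrow> real \<Rightarrow> real" where
  "V5 \<xi> t = t\<^sup>2 * deriv (deriv \<xi>) t - 4 * t * deriv \<xi> t + 6 * \<xi> t"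

definition E_fun :: "(real \<Rightarrow> real) \<Rightarrow> real \<Rightarrow> real" where
  "E_fun \<xi> t = 3 * (\<xi> t)\<^sup>2 - t\<^sup>2 * (deriv \<xi> t)\<^sup>2
     + 2 * t * \<xi> t * (t * deriv (deriv \<xi>) t - deriv \<xi> t)"

definition L1 :: "(real \<Rightarrow> real) \<Rightarrow> real \<Rightarrow> real" where
  "L1 \<xi> t = 2 * (3 * (\<xi> t)\<^sup>2 - 2 * t * \<xi> t * deriv \<xi> t - t\<^sup>2 * (deriv \<xi> t)\<^sup>2
     + 2 * t\<^sup>2 * \<xi> t * deriv (deriv \<xi>) t) / (t ^ 3 * V5 \<xi> t)"

definition L2 :: "(real \<Rightarrow> real) \<Rightarrow> real \<Rightarrow> real" where
  "L2 \<xi> t = (2 * deriv \<xi> t * V1 \<xi> t + t * \<xi> t * deriv (deriv \<xi>) t) * V5 \<xi> t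
     / (3 * t\<^sup>2 * E_fun \<xi> t)"

definition L3 :: "(real \<Rightarrow> real) \<Rightarrow> real \<Rightarrow> real" where
  "L3 \<xi> t = V1 \<xi> t * V5 \<xi> t / (2 * E_fun \<xi> t)"

definition L4 :: "(real \<Rightarrow> real) \<Rightarrow> real \<Rightarrow> real" where
  "L4 \<xi> t = 2 * (2 * deriv \<xi> t + t * deriv (deriv \<xi>) t) / (3 * t\<^sup>2)"

definition L5 :: "(real \<Rightarrow> real) \<Rightarrow> real \<Rightarrow> real" where
  "L5 \<xi> t = 1"

end

theory Submission
  imports Defs
begin

text \<open>
  The tangent space splits orthogonally into the \<open>(t, z)\<close>-plane and the tangent plane of the
  spheres, so \<open>g = P + T\<close>. The Riemann and Weyl tensors have the form
  \<open>a/2 P \<and> P + b P \<and> T + c/2 T \<and> T\<close>, with the Weyl tensor having coefficients \<open>(x, -x/2, x)\<close>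
  where \<open>3x = a - 2b + c\<close>, and the Ricci tensor is \<open>(a + 2b) P + (2b + c) T\<close>. For tensors of this
  form \<open>A \<cdot> U = b\<^sub>A Q(g, U)\<close>, and \<open>Q(l P + m T, U)\<close> is a combination of the two fixed tensors
  \<open>Q(P, P \<and> T)\<close> and \<open>Q(P, T \<and> T)\<close>. Each identity thus reduces to two scalar equations
  in \<open>a, b, c\<close>.
\<close>

section \<open>Algebra of split tensors\<close>

definition split_form :: "'n::finite tensor2 \<Rightarrow> 'n tensor2 \<Rightarrow> real \<Rightarrow> real \<Rightarrow> 'n tensor2" where
  "split_form P T l m X Y = l * P X Y + m * T X Y"

definition split_curvature ::
    "'n::finite tensor2 \<Rightarrow> 'n tensor2 \<Rightarrow> real \<Rightarrow> real \<Rightarrow> real \<Rightarrow> 'n tensor4" where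
  "split_curvature P T a b c X1 X2 X3 X4 =
     a * (kulkarni_nomizu P P X1 X2 X3 X4 / 2) + b * kulkarni_nomizu P T X1 X2 X3 X4
     + c * (kulkarni_nomizu T T X1 X2 X3 X4 / 2)"

lemma kulkarni_nomizu_split_form:
  assumes "\<And>X Y. P X Y = P Y X" and "\<And>X Y. T X Y = T Y X"
  shows "kulkarni_nomizu (split_form P T l m) (split_form P T l' m') X1 X2 X3 X4 =
    split_curvature P T (2 * l * l') (l * m' + m * l') (2 * m * m') X1 X2 X3 X4"
  unfolding split_curvature_def split_form_def kulkarni_nomizu_def by (simp add: field_simps)

text \<open>For symmetric \<open>B\<close> one has \<open>Q(B, B \<and> B) = 0\<close>. Expanding
  this at \<open>B = P + s T\<close> in powers of \<open>s\<close> gives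
  \<open>Q(T, P \<and> P) = - 2 Q(P, P \<and> T)\<close> and
  \<open>2 Q(T, P \<and> T) = - Q(P, T \<and> T)\<close>. The second tensor on the right is half of
  \<open>Q(P, T \<and> T)\<close>.\<close>

lemma tachibana_split_form:
  assumes P: "\<And>X Y. P X Y = P Y X" and T: "\<And>X Y. T X Y = T Y X"
  shows "tachibana (split_form P T l m) (split_curvature P T a b c) X1 X2 X3 X4 X Y =
    (l * b - m * a) * tachibana P (kulkarni_nomizu P T) X1 X2 X3 X4 X Y
    + (l * c - m * b) * tachibana P (split_curvature P T 0 0 1) X1 X2 X3 X4 X Y"
  unfolding tachibana_def split_curvature_def split_form_def kulkarni_nomizu_def
  \<comment> \<open>Symmetry is applied at chosen arguments, so that each value of \<open>P\<close>
    and \<open>T\<close> appears in one order and is a single unknown for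
    \<open>algebra\<close>.\<close>
  by (simp add: P[of _ X1] P[of X4] P[of _ X2] P[of X3 Y] P[of X3 X] P[of Y X]
      T[of _ X1] T[of X4] T[of _ X2] T[of X3 Y] T[of X3 X] T[of Y X]) algebra

text \<open>This combination has the shape of the Weyl tensor,
  \<open>R - 1/2 g \<and> S + \<kappa>/12 g \<and> g\<close>.\<close>

lemma split_curvature_arith:
  "split_curvature P T a b c X1 X2 X3 X4 - r * split_curvature P T a' b' c' X1 X2 X3 X4
    + s * split_curvature P T a'' b'' c'' X1 X2 X3 X4
   = split_curvature P T (a - r * a' + s * a'') (b - r * b' + s * b'') (c - r * c' + s * c'')
       X1 X2 X3 X4"
  unfolding split_curvature_def by (simp add: field_simps)

section \<open>Orthogonal splittings of the tangent space\<close>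

definition base_form ::
    "'n::finite metric_field \<Rightarrow> real^'n \<Rightarrow> (real^'n \<Rightarrow> real^'n) \<Rightarrow> 'n tensor2" where
  "base_form g p \<pi> X Y = metric_form g p (\<pi> X) Y"

definition fibre_form ::
    "'n::finite metric_field \<Rightarrow> real^'n \<Rightarrow> (real^'n \<Rightarrow> real^'n) \<Rightarrow> 'n tensor2" where
  "fibre_form g p \<pi> X Y = metric_form g p (X - \<pi> X) Y"

text \<open>A self-adjoint idempotent is the orthogonal projection onto its image, and its kernel is
  the other summand. The metric may be indefinite, hence nondegeneracy in place of
  positivity.\<close>

locale orthogonal_splitting =
  fixes g :: "'n::finite metric_field" and p :: "real^'n" and \<pi> :: "real^'n \<Rightarrow> real^'n"
  assumes metric_sym: "metric_form g p X Y = metric_form g p Y X"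
    and nondegenerate: "(\<And>W. metric_form g p V W = 0) \<Longrightarrow> V = 0"
    and idem: "\<pi> (\<pi> X) = \<pi> X"
    and self_adjoint: "metric_form g p (\<pi> X) Y = metric_form g p X (\<pi> Y)"
begin

abbreviation "P \<equiv> base_form g p \<pi>"

abbreviation "T \<equiv> fibre_form g p \<pi>"

lemma metric_add: "metric_form g p (U + V) W = metric_form g p U W + metric_form g p V W"
  by (simp add: metric_form_def sum.distrib algebra_simps)

lemma metric_scale: "metric_form g p (r *\<^sub>R U) W = r * metric_form g p U W"
  by (simp add: metric_form_def sum_distrib_left algebra_simps)

lemma metric_diff: "metric_form g p (U - V) W = metric_form g p U W - metric_form g p V W"
  by (simp add: metric_form_def sum_subtractf algebra_simps)

lemma metric_eq_split_form: "metric_form g p = split_form P T 1 1"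
  by (simp add: fun_eq_iff split_form_def base_form_def fibre_form_def metric_diff)

lemma P_sym: "P X Y = P Y X"
  unfolding base_form_def using metric_sym self_adjoint by metis

lemma T_sym: "T X Y = T Y X"
  unfolding fibre_form_def metric_diff using P_sym metric_sym unfolding base_form_def by metis

lemma T_eq: "T X Y = metric_form g p X Y - P X Y"
  by (simp add: fibre_form_def base_form_def metric_diff)

lemma P_left:
  "P (U + V) W = P U W + P V W" "P (U - V) W = P U W - P V W" "P (r *\<^sub>R U) W = r * P U W"
  "P (\<pi> U) W = P U W"
  by (simp_all add: base_form_def idem)
    (simp_all add: self_adjoint metric_add metric_scale metric_diff)

lemma T_left:
  "T (U + V) W = T U W + T V W" "T (U - V) W = T U W - T V W" "T (r *\<^sub>R U) W = r * T U W"
  "T (\<pi> U) W = 0"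
  by (simp_all add: T_eq P_left metric_add metric_scale metric_diff algebra_simps)
    (simp add: base_form_def)

text \<open>Nondegeneracy makes the representing vector unique, so exhibiting one evaluates the
  definite description.\<close>

lemma assoc_op_eqI:
  assumes "\<And>W. metric_form g p V W = A X Y Z W"
  shows "assoc_op g p A X Y Z = V"
  unfolding assoc_op_def
proof (rule the_equality)
  show "\<forall>W. metric_form g p V W = A X Y Z W" using assms by simp
  fix V' assume "\<forall>W. metric_form g p V' W = A X Y Z W"
  then have "metric_form g p (V' - V) W = 0" for W
    using assms by (simp add: metric_diff)
  then show "V' = V" using nondegenerate by fastforce
qed

text \<open>This is \<open>split_curvature\<close> with its last index raised: \<open>P X\<close> is
  represented by \<open>\<pi> X\<close> and \<open>T X\<close> by
  \<open>X - \<pi> X\<close>.\<close>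

definition split_operator ::
    "real \<Rightarrow> real \<Rightarrow> real \<Rightarrow> real^'n \<Rightarrow> real^'n \<Rightarrow> real^'n \<Rightarrow> real^'n" where
  "split_operator a b c X Y Z =
     (a * P Y Z + b * T Y Z) *\<^sub>R \<pi> X - (a * P X Z + b * T X Z) *\<^sub>R \<pi> Y
     + (b * P Y Z + c * T Y Z) *\<^sub>R (X - \<pi> X) - (b * P X Z + c * T X Z) *\<^sub>R (Y - \<pi> Y)"

lemma metric_split_operator:
  "metric_form g p (split_operator a b c X Y Z) W = split_curvature P T a b c X Y Z W"
  unfolding split_operator_def metric_add metric_diff[of "_ + _"]
    metric_diff[of "_ *\<^sub>R _" "_ *\<^sub>R _"] metric_scale
    base_form_def[of g p \<pi>, symmetric] fibre_form_def[of g p \<pi>, symmetric]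
    split_curvature_def kulkarni_nomizu_def
  by (simp add: field_simps)

lemma assoc_op_split_curvature:
  "assoc_op g p (split_curvature P T a b c) X Y Z = split_operator a b c X Y Z"
  by (rule assoc_op_eqI) (rule metric_split_operator)

text \<open>
  For \<open>X\<close> and \<open>Y\<close> in different summands the first tensor acts with the coefficient \<open>b\<close>; for
  \<open>X\<close> and \<open>Y\<close> in the same summand both sides vanish, so \<open>a\<close> and \<open>c\<close> do not enter.
\<close>

lemma curv_dot_split_curvature:
  "curv_dot g p (split_curvature P T a b c) (split_curvature P T a' b' c') X1 X2 X3 X4 X Y =
     b * tachibana (metric_form g p) (split_curvature P T a' b' c') X1 X2 X3 X4 X Y"
  unfolding curv_dot_def assoc_op_split_curvature split_operator_def metric_eq_split_form
    tachibana_def split_curvature_def split_form_def kulkarni_nomizu_def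
  \<comment> \<open>Symmetry moves sums, multiples and projections into the first argument, where
    \<open>P_left\<close> and \<open>T_left\<close> expand them.\<close>
  apply (simp add: P_left T_left P_sym[of _ "_ + _"] P_sym[of _ "_ - _"]
      T_sym[of _ "_ + _"] T_sym[of _ "_ - _"]
      P_sym[of _ "_ *\<^sub>R _"] T_sym[of _ "_ *\<^sub>R _"] P_sym[of _ "\<pi> _"] T_sym[of _ "\<pi> _"])
  apply (simp add: P_sym[of _ X1] P_sym[of X4] P_sym[of _ X2] P_sym[of X3 Y]
      P_sym[of X3 X] P_sym[of Y X]
      T_sym[of _ X1] T_sym[of X4] T_sym[of _ X2] T_sym[of X3 Y] T_sym[of X3 X] T_sym[of Y X])
  by algebra

end

text \<open>Each pair compares the coefficients of \<open>Q(P, P \<and> T)\<close> and of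
  \<open>Q(P, T \<and> T) / 2\<close> in one identity. The Riemann tensor has coefficients
  \<open>(a, b, c)\<close>, the Weyl tensor \<open>(x, - x / 2, x)\<close>, the Ricci tensor
  \<open>(l, m)\<close> and the metric \<open>(1, 1)\<close>.\<close>

lemma
  fixes a b c x d :: real
  assumes d: "d = a * c - b\<^sup>2" and "x \<noteq> 0" "d \<noteq> 0"
    and l: "l = a + 2 * b" and m: "m = 2 * b + c"
  shows coefficients_i:
    "b * (b - a) - (l * b - m * a) = - 2 * d / (3 * x) * (- x / 2 - x)"
    "b * (c - b) - (l * c - m * b) = - 2 * d / (3 * x) * (x - - x / 2)"
  and coefficients_ii:
    "- x / 2 * (b - a) - b * (- x / 2 - x) =
       - x * (a * c - 4 * b\<^sup>2) / (2 * d) * (b - a) + - 3 * b * x / (2 * d) * (l * b - m * a)"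
    "- x / 2 * (c - b) - b * (x - - x / 2) =
       - x * (a * c - 4 * b\<^sup>2) / (2 * d) * (c - b) + - 3 * b * x / (2 * d) * (l * c - m * b)"
  and coefficients_iii:
    "- x / 2 * (b - a) - b * (- x / 2 - x) =
       - 2 * (a + 4 * b + c) / 3 * (- x / 2 - x) + (l * (- x / 2) - m * x)"
    "- x / 2 * (c - b) - b * (x - - x / 2) =
       - 2 * (a + 4 * b + c) / 3 * (x - - x / 2) + (l * x - m * (- x / 2))"
proof -
  have "- 2 * d / (3 * x) * (- x / 2 - x) = d" "- 2 * d / (3 * x) * (x - - x / 2) = - d"
    using \<open>x \<noteq> 0\<close> by (simp_all add: field_simps)
  then show "b * (b - a) - (l * b - m * a) = - 2 * d / (3 * x) * (- x / 2 - x)"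
    "b * (c - b) - (l * c - m * b) = - 2 * d / (3 * x) * (x - - x / 2)"
    unfolding d l m by (simp_all add: algebra_simps power2_eq_square)
  \<comment> \<open>Over the common denominator \<open>2 * d\<close> the numerators on the right
    contain the factor \<open>d\<close>, which then cancels.\<close>
  have numerators:
    "- x * (a * c - 4 * b\<^sup>2) * (b - a) + - 3 * b * x * (l * b - m * a) = x * (a + 2 * b) * d"
    "- x * (a * c - 4 * b\<^sup>2) * (c - b) + - 3 * b * x * (l * c - m * b) = - x * (c + 2 * b) * d"
    unfolding d l m by algebra+
  have add_fractions: "p / e * u + r / e * v = (p * u + r * v) / e" for p e u r v :: real
    by (simp add: add_divide_distrib)
  show "- x / 2 * (b - a) - b * (- x / 2 - x) =
       - x * (a * c - 4 * b\<^sup>2) / (2 * d) * (b - a) + - 3 * b * x / (2 * d) * (l * b - m * a)"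
    "- x / 2 * (c - b) - b * (x - - x / 2) =
       - x * (a * c - 4 * b\<^sup>2) / (2 * d) * (c - b) + - 3 * b * x / (2 * d) * (l * c - m * b)"
    unfolding add_fractions numerators using \<open>d \<noteq> 0\<close> by (simp_all add: field_simps)
  show "- x / 2 * (b - a) - b * (- x / 2 - x) =
       - 2 * (a + 4 * b + c) / 3 * (- x / 2 - x) + (l * (- x / 2) - m * x)"
    "- x / 2 * (c - b) - b * (x - - x / 2) =
       - 2 * (a + 4 * b + c) / 3 * (x - - x / 2) + (l * x - m * (- x / 2))"
    unfolding l m by (simp_all add: field_simps)
qed

section \<open>Diagonal matrices and partial derivatives\<close>

lemma sum_diagonal_left:
  fixes c :: real and i :: "'n::finite"
  shows "(\<Sum>k\<in>UNIV. (if i \<noteq> k then 0 else c) * f k) = c * f i"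
proof -
  have "(\<Sum>k\<in>UNIV. (if i \<noteq> k then 0 else c) * f k) = (\<Sum>k\<in>UNIV. if k = i then c * f i else 0)"
    by (rule sum.cong) auto
  then show ?thesis by simp
qed

text \<open>\<open>matrix_inv\<close> is a choice of two-sided inverse: the explicit inverse shows
  that one exists, and associativity forces the chosen one to equal it.\<close>

lemma matrix_inv_diagonal:
  fixes d :: "'n::finite \<Rightarrow> real"
  assumes "\<And>i. d i \<noteq> 0"
  shows "matrix_inv (\<chi> i j. if i \<noteq> j then 0 else d i) =
    (\<chi> i j. if i \<noteq> j then 0 else inverse (d i))" (is "matrix_inv ?A = ?B")
proof -
  have AB: "?A ** ?B = mat 1" and BA: "?B ** ?A = mat 1"
    using assms by (simp_all add: matrix_matrix_mult_def mat_def vec_eq_iff sum_diagonal_left)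
  have "\<exists>A'. ?A ** A' = mat 1 \<and> A' ** ?A = mat 1"
    using AB BA by blast
  then have A: "?A ** matrix_inv ?A = mat 1"
    unfolding matrix_inv_def by (rule someI2_ex) simp
  have "matrix_inv ?A = (?B ** ?A) ** matrix_inv ?A" by (simp add: BA)
  also have "\<dots> = ?B" by (simp only: matrix_mul_assoc[symmetric] A matrix_mul_rid)
  finally show ?thesis .
qed

lemma partial_eqI: "(f has_derivative f') (at p) \<Longrightarrow> partial i f p = f' (axis i 1)"
  unfolding partial_def using frechet_derivative_at by metis

lemma cos_mult_cos: "cos x * cos x = 1 - sin x * sin (x::real)"
  using sin_cos_squared_add3[of x] by linarith

section \<open>The chart and the derivatives of the metric\<close>

locale ibh_chart =
  fixes \<xi> :: "real \<Rightarrow> real" and I :: "real set"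
  assumes open_I: "open I" and pos_I: "I \<subseteq> {0<..}" and smooth: "smooth_on I \<xi>"
begin

text \<open>The first two diagonal components of the metric are \<open>- 1 / h\<close> and
  \<open>h\<close>, so connection and curvature are computed in terms of \<open>h\<close>.\<close>

definition h :: "real \<Rightarrow> real" where "h t = 2 * \<xi> t / t - 1"

definition h' :: "real \<Rightarrow> real" where "h' t = - 2 * V1 \<xi> t / t\<^sup>2"

definition h'' :: "real \<Rightarrow> real" where
  "h'' t = 2 * (t\<^sup>2 * deriv (deriv \<xi>) t - 2 * t * deriv \<xi> t + 2 * \<xi> t) / t ^ 3"

lemma DERIV_xi:
  assumes "t \<in> I"
  shows "DERIV \<xi> t :> deriv \<xi> t" and "DERIV (deriv \<xi>) t :> deriv (deriv \<xi>) t"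
proof -
  \<comment> \<open>Since \<open>I\<close> is open, differentiability within \<open>I\<close> is
    differentiability at \<open>t\<close>; the cases 0 and 1 of \<open>n\<close> give the
    claims.\<close>
  have "((deriv ^^ n) \<xi>) differentiable (at t)" for n
    using smooth open_I assms unfolding smooth_on_def
    by (metis differentiable_on_eq_differentiable_at)
  from this[of 0] this[of 1] show "DERIV \<xi> t :> deriv \<xi> t"
    "DERIV (deriv \<xi>) t :> deriv (deriv \<xi>) t"
    by (simp_all add: DERIV_deriv_iff_real_differentiable)
qed

lemma DERIV_h:
  assumes "t \<in> I"
  shows "DERIV h t :> h' t" and "DERIV h' t :> h'' t"
proof -
  have t: "t > 0" using assms pos_I by auto
  note [derivative_intros] = DERIV_xi[OF assms]
  show "DERIV h t :> h' t"
    unfolding h_def[abs_def] h'_def V1_def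
    using t by (auto intro!: derivative_eq_intros simp: field_simps power2_eq_square)
  show "DERIV h' t :> h'' t"
    unfolding h'_def[abs_def] h''_def V1_def
    using t by (auto intro!: derivative_eq_intros simp: field_simps power2_eq_square power3_eq_cube)
qed

lemma has_derivative_h [derivative_intros]:
  assumes "q $ 1 \<in> I"
  shows "((\<lambda>x::real^4. h (x $ 1)) has_derivative (\<lambda>x. h' (q $ 1) * x $ 1)) (at q)"
    and "((\<lambda>x::real^4. h' (x $ 1)) has_derivative (\<lambda>x. h'' (q $ 1) * x $ 1)) (at q)"
  by (rule has_derivative_compose[of "\<lambda>x. x $ 1", simplified],
      rule bounded_linear.has_derivative[OF bounded_linear_vec_nth], rule has_derivative_ident,
      use DERIV_h[OF assms] in \<open>simp add: has_field_derivative_def\<close>)+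

lemmas nth_derivative [derivative_intros] =
  bounded_linear.has_derivative[OF bounded_linear_vec_nth]

abbreviation "M \<equiv> ibh_domain \<xi> I"

abbreviation "g \<equiv> ibh_metric \<xi>"

lemma h_nonzero: "q \<in> M \<Longrightarrow> h (q $ 1) \<noteq> 0"
  using pos_I by (auto simp: h_def ibh_domain_def field_simps)

lemma t_pos: "q \<in> M \<Longrightarrow> q $ 1 > 0"
  using pos_I by (auto simp: ibh_domain_def)

lemma sin_pos: "q \<in> M \<Longrightarrow> sin (q $ 3) > 0"
  by (auto simp: ibh_domain_def intro: sin_gt_zero)

text \<open>The closed form of the connection holds on \<open>M\<close>; openness allows
  differentiating it at a point of \<open>M\<close>. Continuity of \<open>\<xi>\<close> makes
  \<open>t \<noteq> 2 * \<xi> t\<close> an open condition.\<close>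

lemma open_M: "open M"
proof -
  have "continuous_on I \<xi>"
    using DERIV_xi(1) by (meson DERIV_isCont continuous_at_imp_continuous_on)
  then have "continuous_on I (\<lambda>t. t - 2 * \<xi> t)" by (intro continuous_intros)
  then have "open (I \<inter> (\<lambda>t. t - 2 * \<xi> t) -` (- {0}))"
    using open_I by (intro continuous_open_preimage) auto
  note * = open_vimage[OF this, of "\<lambda>p::real^4. p $ 1"]
  have "open ((\<lambda>p::real^4. p $ 1) -` (I \<inter> (\<lambda>t. t - 2 * \<xi> t) -` (- {0}))
      \<inter> (\<lambda>p. p $ 3) -` {0<..<pi})"
    by (intro open_Int * open_vimage[OF open_greaterThanLessThan] continuous_intros)
  also have "(\<lambda>p::real^4. p $ 1) -` (I \<inter> (\<lambda>t. t - 2 * \<xi> t) -` (- {0}))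
      \<inter> (\<lambda>p. p $ 3) -` {0<..<pi} = M"
    by (auto simp: ibh_domain_def)
  finally show ?thesis .
qed

definition diag :: "real^4 \<Rightarrow> 4 \<Rightarrow> real" where
  "diag q i = (if i = 1 then - inverse (h (q $ 1)) else if i = 2 then h (q $ 1)
     else if i = 3 then (q $ 1)\<^sup>2 else (q $ 1)\<^sup>2 * (sin (q $ 3))\<^sup>2)"

lemma ibh_metric_diag: "g q = (\<chi> i j. if i \<noteq> j then 0 else diag q i)"
  by (auto simp: ibh_metric_def diag_def h_def vec_eq_iff)

lemma diag_nonzero: "q \<in> M \<Longrightarrow> diag q i \<noteq> 0"
  using h_nonzero[of q] t_pos[of q] sin_pos[of q] by (auto simp: diag_def)

lemma matrix_inv_ibh:
  "q \<in> M \<Longrightarrow> matrix_inv (g q) = (\<chi> i j. if i \<noteq> j then 0 else inverse (diag q i))"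
  unfolding ibh_metric_diag by (rule matrix_inv_diagonal) (rule diag_nonzero)

definition diag_deriv :: "real^4 \<Rightarrow> 4 \<Rightarrow> real^4 \<Rightarrow> real" where
  "diag_deriv q i x = (if i = 1 then h' (q $ 1) / (h (q $ 1))\<^sup>2 * x $ 1
     else if i = 2 then h' (q $ 1) * x $ 1
     else if i = 3 then 2 * q $ 1 * x $ 1
     else 2 * q $ 1 * (sin (q $ 3))\<^sup>2 * x $ 1
       + 2 * (q $ 1)\<^sup>2 * sin (q $ 3) * cos (q $ 3) * x $ 3)"

lemma has_derivative_diag:
  assumes "q \<in> M"
  shows "((\<lambda>x. diag x i) has_derivative diag_deriv q i) (at q)"
proof -
  have I: "q $ 1 \<in> I" using assms by (simp add: ibh_domain_def)
  have "((\<lambda>x. - inverse (h (x $ 1))) has_derivative (\<lambda>x. h' (q $ 1) / (h (q $ 1))\<^sup>2 * x $ 1)) (at q)"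
    using h_nonzero[OF assms]
    by (auto intro!: derivative_eq_intros I simp: field_simps power2_eq_square)
  moreover have "((\<lambda>x::real^4. (x $ 1)\<^sup>2 * (sin (x $ 3))\<^sup>2) has_derivative
      (\<lambda>x. 2 * q $ 1 * (sin (q $ 3))\<^sup>2 * x $ 1
        + 2 * (q $ 1)\<^sup>2 * sin (q $ 3) * cos (q $ 3) * x $ 3)) (at q)"
    by (auto intro!: derivative_eq_intros simp: algebra_simps power2_eq_square)
  moreover have "((\<lambda>x::real^4. (x $ 1)\<^sup>2) has_derivative (\<lambda>x. 2 * q $ 1 * x $ 1)) (at q)"
    by (auto intro!: derivative_eq_intros)
  ultimately show ?thesis
    unfolding diag_def diag_deriv_def using has_derivative_h(1)[OF I]
    by (cases "i = 1"; cases "i = 2"; cases "i = 3"; simp only: if_True if_False simp_thms)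
qed

section \<open>The Levi-Civita connection\<close>

lemma partial_ibh:
  assumes "q \<in> M"
  shows "partial l (\<lambda>x. g x $ i $ j) q = (if i \<noteq> j then 0 else diag_deriv q i (axis l 1))"
  by (simp add: ibh_metric_diag partial_eqI[OF has_derivative_diag[OF assms]]
      partial_eqI[OF has_derivative_const])

lemma christoffel_ibh:
  assumes "q \<in> M"
  shows "christoffel g q i j k = (1/2) * inverse (diag q k) *
     ((if j = k then diag_deriv q k (axis i 1) else 0)
      + (if i = k then diag_deriv q k (axis j 1) else 0)
      - (if i = j then diag_deriv q i (axis k 1) else 0))"
  unfolding christoffel_def partial_ibh[OF assms] matrix_inv_ibh[OF assms]
  by (simp add: sum_diagonal_left)

text \<open>The Christoffel part of the covariant derivative, as a bilinear map in closed
  form.\<close>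

definition conn :: "real^4 \<Rightarrow> real^4 \<Rightarrow> real^4 \<Rightarrow> real^4" where
  "conn q Y Z =
    (let t = q $ 1; s = sin (q $ 3); c = cos (q $ 3) in
      (- h' t / (2 * h t) * Y $ 1 * Z $ 1 + h t * h' t / 2 * Y $ 2 * Z $ 2
        + h t * t * (Y $ 3 * Z $ 3 + s\<^sup>2 * Y $ 4 * Z $ 4)) *\<^sub>R axis 1 1
      + (h' t / (2 * h t) * (Y $ 1 * Z $ 2 + Y $ 2 * Z $ 1)) *\<^sub>R axis 2 1
      + ((Y $ 1 * Z $ 3 + Y $ 3 * Z $ 1) / t - s * c * Y $ 4 * Z $ 4) *\<^sub>R axis 3 1
      + ((Y $ 1 * Z $ 4 + Y $ 4 * Z $ 1) / t + c / s * (Y $ 3 * Z $ 4 + Y $ 4 * Z $ 3)) *\<^sub>R axis 4 1)"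

lemma conn_eq:
  assumes "q \<in> M"
  shows "(\<chi> k. \<Sum>i\<in>UNIV. \<Sum>j\<in>UNIV. christoffel g q i j k * Y $ i * Z $ j) = conn q Y Z"
  unfolding vec_eq_iff forall_4 christoffel_ibh[OF assms]
  using h_nonzero[OF assms] t_pos[OF assms] sin_pos[OF assms]
  by (simp add: sum_4 conn_def Let_def diag_def diag_deriv_def axis_def)
    (simp add: field_simps power2_eq_square)

lemma levi_civita_ibh:
  "q \<in> M \<Longrightarrow> levi_civita g X Y q = frechet_derivative Y (at q) (X q) + conn q (X q) (Y q)"
  by (simp add: levi_civita_def conn_eq)

text \<open>The differential of \<open>conn q Y Z\<close> with respect to \<open>q\<close> in
  direction \<open>x\<close>, with \<open>Y\<close> and \<open>Z\<close> fixed; \<open>r\<close> is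
  the derivative of \<open>h' t / (2 * h t)\<close>.\<close>

definition conn_deriv :: "real^4 \<Rightarrow> real^4 \<Rightarrow> real^4 \<Rightarrow> real^4 \<Rightarrow> real^4" where
  "conn_deriv q Y Z x =
    (let t = q $ 1; s = sin (q $ 3); c = cos (q $ 3);
         r = (h'' t * h t - (h' t)\<^sup>2) / (2 * (h t)\<^sup>2) in
      (x $ 1 * (- r * Y $ 1 * Z $ 1 + (h' t * h' t + h t * h'' t) / 2 * Y $ 2 * Z $ 2
          + (h' t * t + h t) * (Y $ 3 * Z $ 3 + s\<^sup>2 * Y $ 4 * Z $ 4))
        + x $ 3 * (2 * h t * t * s * c * Y $ 4 * Z $ 4)) *\<^sub>R axis 1 1
      + (x $ 1 * r * (Y $ 1 * Z $ 2 + Y $ 2 * Z $ 1)) *\<^sub>R axis 2 1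
      + (- x $ 1 * (Y $ 1 * Z $ 3 + Y $ 3 * Z $ 1) / t\<^sup>2
          - x $ 3 * (c\<^sup>2 - s\<^sup>2) * Y $ 4 * Z $ 4) *\<^sub>R axis 3 1
      + (- x $ 1 * (Y $ 1 * Z $ 4 + Y $ 4 * Z $ 1) / t\<^sup>2
          - x $ 3 / s\<^sup>2 * (Y $ 3 * Z $ 4 + Y $ 4 * Z $ 3)) *\<^sub>R axis 4 1)"

lemma has_derivative_conn:
  assumes "q \<in> M"
  shows "((\<lambda>x. conn x Y Z) has_derivative conn_deriv q Y Z) (at q)"
proof -
  have I: "q $ 1 \<in> I" using assms by (simp add: ibh_domain_def)
  note defs = conn_def conn_deriv_def Let_def axis_def
  have "((\<lambda>x. conn x Y Z $ 1) has_derivative (\<lambda>x. conn_deriv q Y Z x $ 1)) (at q)"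
    "((\<lambda>x. conn x Y Z $ 2) has_derivative (\<lambda>x. conn_deriv q Y Z x $ 2)) (at q)"
    using h_nonzero[OF assms] I
    by (auto intro!: derivative_eq_intros simp: defs field_simps power2_eq_square)
  moreover have "((\<lambda>x. conn x Y Z $ 3) has_derivative (\<lambda>x. conn_deriv q Y Z x $ 3)) (at q)"
    using t_pos[OF assms]
    by (auto intro!: derivative_eq_intros simp: defs field_simps power2_eq_square)
  \<comment> \<open>The cotangent has derivative
    \<open>- (s\<^sup>2 + c\<^sup>2) / s\<^sup>2\<close>, which \<open>cos_mult_cos\<close> reduces
    to \<open>- 1 / s\<^sup>2\<close>.\<close>
  moreover have "((\<lambda>x. conn x Y Z $ 4) has_derivative (\<lambda>x. conn_deriv q Y Z x $ 4)) (at q)"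
    using t_pos[OF assms] sin_pos[OF assms]
    by (auto intro!: derivative_eq_intros simp: defs field_simps power2_eq_square cos_mult_cos)
  ultimately have "((\<lambda>x. conn x Y Z $ i) has_derivative (\<lambda>x. conn_deriv q Y Z x $ i)) (at q)" for i
    using exhaust_4[of i] by metis
  then show ?thesis
    by (subst has_derivative_componentwise_within) (auto simp: Basis_vec_def inner_axis)
qed

section \<open>The curvature operator\<close>

lemma curvature_op_ibh:
  assumes "q \<in> M"
  shows "curvature_op g (\<lambda>_. X) (\<lambda>_. Y) (\<lambda>_. Z) q =
    conn_deriv q X Z Y + conn q Y (conn q X Z) - conn_deriv q Y Z X - conn q X (conn q Y Z)"
proof -
  have D: "frechet_derivative (levi_civita g (\<lambda>_. U) (\<lambda>_. V)) (at q) = conn_deriv q U V" for U V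
  proof -
    \<comment> \<open>On constant fields the covariant derivative agrees with \<open>conn\<close>
      throughout the open set \<open>M\<close>, so both have the same derivative at
      \<open>q\<close>.\<close>
    have "(levi_civita g (\<lambda>_. U) (\<lambda>_. V) has_derivative conn_deriv q U V) (at q)"
      by (rule has_derivative_transform_within_open[OF has_derivative_conn[OF assms] open_M assms])
        (simp add: levi_civita_ibh)
    then show ?thesis by (simp add: frechet_derivative_at[symmetric])
  qed
  \<comment> \<open>The bracket of constant fields is zero, so this disposes of the bracket
    term.\<close>
  have "conn q 0 Z = 0" by (simp add: conn_def)
  then show ?thesis
    by (simp add: curvature_op_def levi_civita_ibh[OF assms] D lie_bracket_def)
qed

text \<open>
  Up to the sign convention, the sectional curvatures of the \<open>(t, z)\<close>-plane, of the mixed planes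
  and of the spherical plane.
\<close>

definition base_curv :: "real \<Rightarrow> real" where "base_curv t = - h'' t / 2"

definition mixed_curv :: "real \<Rightarrow> real" where "mixed_curv t = - h' t / (2 * t)"

definition sphere_curv :: "real \<Rightarrow> real" where "sphere_curv t = - (1 + h t) / t\<^sup>2"

definition proj :: "real^4 \<Rightarrow> real^4" where
  "proj X = (\<chi> i. if i = 1 \<or> i = 2 then X $ i else 0)"

lemma metric_form_ibh: "metric_form g q X Y = (\<Sum>i\<in>UNIV. diag q i * X $ i * Y $ i)"
  unfolding metric_form_def ibh_metric_diag
  by (simp add: sum_diagonal_left mult.assoc)

abbreviation "P q \<equiv> base_form g q proj"

abbreviation "T q \<equiv> fibre_form g q proj"

lemma P_eq: "P q X Y = - X $ 1 * Y $ 1 / h (q $ 1) + h (q $ 1) * X $ 2 * Y $ 2"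
  by (simp add: base_form_def metric_form_ibh sum_4 proj_def diag_def field_simps)

lemma T_eq: "T q X Y = (q $ 1)\<^sup>2 * (X $ 3 * Y $ 3 + (sin (q $ 3))\<^sup>2 * X $ 4 * Y $ 4)"
  by (simp add: fibre_form_def metric_form_ibh sum_4 proj_def diag_def field_simps)

text \<open>The right-hand side is \<open>split_operator\<close> for the three curvatures, written
  out. The proof is a componentwise computation.\<close>

lemma curvature_op_ibh_eq:
  assumes "q \<in> M"
  shows "curvature_op g (\<lambda>_. X) (\<lambda>_. Y) (\<lambda>_. Z) q =
    (base_curv (q $ 1) * P q Y Z + mixed_curv (q $ 1) * T q Y Z) *\<^sub>R proj X
    - (base_curv (q $ 1) * P q X Z + mixed_curv (q $ 1) * T q X Z) *\<^sub>R proj Y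
    + (mixed_curv (q $ 1) * P q Y Z + sphere_curv (q $ 1) * T q Y Z) *\<^sub>R (X - proj X)
    - (mixed_curv (q $ 1) * P q X Z + sphere_curv (q $ 1) * T q X Z) *\<^sub>R (Y - proj Y)"
  (is "_ = ?R")
proof -
  define t s c u v w k where "t = q $ 1" "s = sin (q $ 3)" "c = cos (q $ 3)"
    "u = inverse (h t)" "v = inverse s" "w = inverse t" "k = inverse (2::real)"
  note vars = this
  have nz: "h (q $ 1) \<noteq> 0" "q $ 1 \<noteq> 0" "sin (q $ 3) \<noteq> 0"
    using h_nonzero[OF assms] t_pos[OF assms] sin_pos[OF assms] by simp_all
  have rel: "u * h t = 1" "v * s = 1" "w * t = 1" "c * c = 1 - s * s" "2 * k = 1"
    using nz by (simp_all add: vars cos_mult_cos)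
  \<comment> \<open>Products of two Christoffel symbols produce quarters, which must also be
    expressed through \<open>k\<close>.\<close>
  have four: "inverse 4 = k * k" by (simp add: vars)
  \<comment> \<open>With inverses as variables the components become polynomial identities modulo \<open>rel\<close>.\<close>
  have "conn_deriv q X Z Y + conn q Y (conn q X Z) - conn_deriv q Y Z X - conn q X (conn q Y Z) = ?R"
    unfolding vec_eq_iff forall_4
    apply (simp add: nz conn_def conn_deriv_def Let_def axis_def proj_def P_eq T_eq
        base_curv_def mixed_curv_def sphere_curv_def)
    apply (simp only: divide_inverse power2_eq_square inverse_mult_distrib vars(1-3)[symmetric])
    apply (simp only: vars(4-7)[symmetric] four)
    apply (intro conjI)
    subgoal using rel by algebra
    subgoal using rel by algebra
    subgoal using rel by algebra
    subgoal using rel by algebra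
    done
  then show ?thesis by (simp add: curvature_op_ibh[OF assms])
qed

section \<open>Riemann, Ricci and Weyl tensors in split form\<close>

lemma orthogonal_splitting_ibh:
  assumes "q \<in> M"
  shows "orthogonal_splitting g q proj"
proof
  fix V
  assume *: "\<And>W. metric_form g q V W = 0"
  have "diag q i * V $ i = 0" for i
    using *[of "axis i 1"] by (simp add: metric_form_ibh axis_def if_distrib cong: if_cong)
  then show "V = 0"
    using diag_nonzero[OF assms] by (simp add: vec_eq_iff)
qed (simp_all add: metric_form_ibh proj_def vec_eq_iff sum_4 mult.commute)

lemma riemann_ibh:
  assumes "q \<in> M"
  shows "riemann g q = split_curvature (P q) (T q)
    (base_curv (q $ 1)) (mixed_curv (q $ 1)) (sphere_curv (q $ 1))"
proof -
  interpret splitting: orthogonal_splitting g q proj by (rule orthogonal_splitting_ibh[OF assms])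
  show ?thesis
    by (simp add: fun_eq_iff riemann_def curvature_op_ibh_eq[OF assms]
        splitting.metric_split_operator[unfolded splitting.split_operator_def])
qed

text \<open>In traces the entries of \<open>diag\<close> cancel against those of the inverse metric,
  so here they are kept unevaluated.\<close>

lemma P_diag: "P q X Y = diag q 1 * X $ 1 * Y $ 1 + diag q 2 * X $ 2 * Y $ 2"
  by (simp add: base_form_def metric_form_ibh sum_4 proj_def)

lemma T_diag: "T q X Y = diag q 3 * X $ 3 * Y $ 3 + diag q 4 * X $ 4 * Y $ 4"
  by (simp add: fibre_form_def metric_form_ibh sum_4 proj_def)

text \<open>Both planes have dimension two, so the contraction takes \<open>P \<and> P / 2\<close>
  to \<open>P\<close>, \<open>T \<and> T / 2\<close> to \<open>T\<close>, and
  \<open>P \<and> T\<close> to \<open>2 (P + T)\<close>.\<close>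

lemma ricci_ibh:
  assumes "q \<in> M"
  shows "ricci g q = split_form (P q) (T q)
    (base_curv (q $ 1) + 2 * mixed_curv (q $ 1)) (2 * mixed_curv (q $ 1) + sphere_curv (q $ 1))"
  unfolding ricci_def fun_eq_iff matrix_inv_ibh[OF assms] riemann_ibh[OF assms]
  using diag_nonzero[OF assms]
  by (simp add: sum_diagonal_left sum_4 split_curvature_def kulkarni_nomizu_def P_diag T_diag axis_def
      split_form_def field_simps)

lemma scalar_curvature_ibh:
  assumes "q \<in> M"
  shows "scalar_curvature g q =
    2 * base_curv (q $ 1) + 8 * mixed_curv (q $ 1) + 2 * sphere_curv (q $ 1)"
  unfolding scalar_curvature_def matrix_inv_ibh[OF assms] ricci_ibh[OF assms]
  using diag_nonzero[OF assms]
  by (simp add: sum_diagonal_left sum_4 split_form_def P_diag T_diag axis_def field_simps)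

definition weyl_curv :: "real \<Rightarrow> real" where
  "weyl_curv t = (base_curv t - 2 * mixed_curv t + sphere_curv t) / 3"

text \<open>The coefficients reflect that the Weyl tensor is trace-free:
  \<open>x + 2 (- x / 2) = 0\<close> on each plane.\<close>

lemma conformal_ibh:
  assumes "q \<in> M"
  shows "conformal g q = split_curvature (P q) (T q)
    (weyl_curv (q $ 1)) (- weyl_curv (q $ 1) / 2) (weyl_curv (q $ 1))"
proof -
  interpret splitting: orthogonal_splitting g q proj by (rule orthogonal_splitting_ibh[OF assms])
  note kn = kulkarni_nomizu_split_form[of "P q" "T q", OF splitting.P_sym splitting.T_sym]
  show ?thesis
    unfolding fun_eq_iff conformal_def splitting.metric_eq_split_form riemann_ibh[OF assms]
      ricci_ibh[OF assms] scalar_curvature_ibh[OF assms] kn split_curvature_arith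
    \<comment> \<open>It suffices that the three coefficients agree.\<close>
    by (auto intro!: arg_cong[where f = "\<lambda>(a, b, c). split_curvature (P q) (T q) a b c _ _ _ _",
          of "(_, _, _)" "(_, _, _)", simplified] simp: weyl_curv_def field_simps)
qed

section \<open>The coefficient functions in terms of the curvatures\<close>

definition curv_disc :: "real \<Rightarrow> real" where
  "curv_disc t = base_curv t * sphere_curv t - (mixed_curv t)\<^sup>2"

text \<open>Up to constants and powers of \<open>t\<close>, the functions \<open>V1\<close>,
  \<open>V5\<close> and \<open>E_fun\<close> are the scalars \<open>b\<close>, \<open>x\<close> and
  \<open>d = a c - b\<^sup>2\<close>. The numerator of \<open>L2\<close> corresponds to
  \<open>a c - 4 b\<^sup>2 = d - 3 b\<^sup>2\<close>.\<close>

lemma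
  assumes "t > 0"
  shows V1_mixed_curv: "V1 \<xi> t = t ^ 3 * mixed_curv t"
    and V5_weyl_curv: "V5 \<xi> t = - 3 * t ^ 3 * weyl_curv t"
    and E_curv_disc: "E_fun \<xi> t = (t ^ 3)\<^sup>2 * curv_disc t"
    and L2_numerator: "2 * t * (2 * deriv \<xi> t * V1 \<xi> t + t * \<xi> t * deriv (deriv \<xi>) t)
      = E_fun \<xi> t - 3 * (V1 \<xi> t)\<^sup>2"
    and L4_curv: "L4 \<xi> t = - 2 * (base_curv t + 4 * mixed_curv t + sphere_curv t) / 3"
  using assms
  by (simp_all add: V1_def V5_def E_fun_def L4_def curv_disc_def weyl_curv_def base_curv_def
      mixed_curv_def sphere_curv_def h_def h'_def h''_def)
    (simp_all add: field_simps power2_eq_square power3_eq_cube eval_nat_numeral)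

lemma
  assumes t: "t > 0" and "V5 \<xi> t \<noteq> 0" "E_fun \<xi> t \<noteq> 0"
  shows weyl_curv_nonzero: "weyl_curv t \<noteq> 0"
    and curv_disc_nonzero: "curv_disc t \<noteq> 0"
    and L1_curv: "L1 \<xi> t = - 2 * curv_disc t / (3 * weyl_curv t)"
    and L2_curv: "L2 \<xi> t = - weyl_curv t
      * (base_curv t * sphere_curv t - 4 * (mixed_curv t)\<^sup>2) / (2 * curv_disc t)"
    and L3_curv: "L3 \<xi> t = - 3 * mixed_curv t * weyl_curv t / (2 * curv_disc t)"
proof -
  show "weyl_curv t \<noteq> 0" and disc: "curv_disc t \<noteq> 0"
    using assms by (auto simp: V5_weyl_curv E_curv_disc)
  have t3: "t ^ 3 \<noteq> 0" using t by simp
  \<comment> \<open>In the cancellation rules \<open>r\<close> stands for \<open>t ^ 3\<close>: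
    \<open>E_fun\<close> carries \<open>r\<^sup>2\<close>, while \<open>V1\<close> and
    \<open>V5\<close> carry \<open>r\<close>.\<close>
  have cancel1: "2 * (r\<^sup>2 * d) / (r * (- 3 * r * x)) = - 2 * d / (3 * x)"
    if "r \<noteq> 0" for r d x :: real
    using that by (simp add: power2_eq_square)
  have cancel2: "r\<^sup>2 * e * (- 3 * r * x) / (6 * r * (r\<^sup>2 * d)) = - x * e / (2 * d)"
    if "r \<noteq> 0" "d \<noteq> 0" for r d e x :: real
    using that by (simp add: field_simps)
  have cancel3: "r * b * (- 3 * r * x) / (2 * (r\<^sup>2 * d)) = - 3 * b * x / (2 * d)"
    if "r \<noteq> 0" "d \<noteq> 0" for r d b x :: real
    using that by (simp add: field_simps power2_eq_square)
  \<comment> \<open>Extending the fraction by \<open>2 * t\<close> produces the left-hand side of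
    \<open>L2_numerator\<close>.\<close>
  have expand: "n * v / (3 * t\<^sup>2 * e) = 2 * t * n * v / (6 * t ^ 3 * e)" for n v e :: real
    using t by (simp add: power2_eq_square power3_eq_cube)
  note curv = V5_weyl_curv[OF t] V1_mixed_curv[OF t] E_curv_disc[OF t]
  have "L1 \<xi> t = 2 * E_fun \<xi> t / (t ^ 3 * V5 \<xi> t)"
    unfolding L1_def E_fun_def by (simp add: algebra_simps power2_eq_square)
  then show "L1 \<xi> t = - 2 * curv_disc t / (3 * weyl_curv t)"
    unfolding curv cancel1[OF t3] .
  have "L2 \<xi> t = (E_fun \<xi> t - 3 * (V1 \<xi> t)\<^sup>2) * V5 \<xi> t / (6 * t ^ 3 * E_fun \<xi> t)"
    unfolding L2_def expand L2_numerator[OF t] ..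
  also have "E_fun \<xi> t - 3 * (V1 \<xi> t)\<^sup>2 =
      (t ^ 3)\<^sup>2 * (base_curv t * sphere_curv t - 4 * (mixed_curv t)\<^sup>2)"
    unfolding curv curv_disc_def by algebra
  finally show "L2 \<xi> t = - weyl_curv t
      * (base_curv t * sphere_curv t - 4 * (mixed_curv t)\<^sup>2) / (2 * curv_disc t)"
    unfolding curv cancel2[OF t3 disc] .
  show "L3 \<xi> t = - 3 * mixed_curv t * weyl_curv t / (2 * curv_disc t)"
    unfolding L3_def curv cancel3[OF t3 disc] ..
qed

section \<open>The three identities\<close>

lemma ibh_identities:
  assumes "q \<in> M" "V5 \<xi> (q $ 1) \<noteq> 0" "E_fun \<xi> (q $ 1) \<noteq> 0"
  shows "curv_dot g q (riemann g q) (riemann g q) X1 X2 X3 X4 X Y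
        - tachibana (ricci g q) (riemann g q) X1 X2 X3 X4 X Y
      = L1 \<xi> (q $ 1) * tachibana (metric_form g q) (conformal g q) X1 X2 X3 X4 X Y" (is ?i)
    and "curv_dot g q (conformal g q) (riemann g q) X1 X2 X3 X4 X Y
        - curv_dot g q (riemann g q) (conformal g q) X1 X2 X3 X4 X Y
      = L2 \<xi> (q $ 1) * tachibana (metric_form g q) (riemann g q) X1 X2 X3 X4 X Y
        + L3 \<xi> (q $ 1) * tachibana (ricci g q) (riemann g q) X1 X2 X3 X4 X Y" (is ?ii)
    and "curv_dot g q (conformal g q) (riemann g q) X1 X2 X3 X4 X Y
        - curv_dot g q (riemann g q) (conformal g q) X1 X2 X3 X4 X Y
      = L4 \<xi> (q $ 1) * tachibana (metric_form g q) (conformal g q) X1 X2 X3 X4 X Y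
        + L5 \<xi> (q $ 1) * tachibana (ricci g q) (conformal g q) X1 X2 X3 X4 X Y" (is ?iii)
proof -
  interpret splitting: orthogonal_splitting g q proj by (rule orthogonal_splitting_ibh[OF assms(1)])
  note tach = tachibana_split_form[of "P q" "T q", OF splitting.P_sym splitting.T_sym]
  \<comment> \<open>Every term of the identities is a combination of \<open>W1\<close> and
    \<open>W2\<close>; the coefficient equations compare the two factors.\<close>
  define a b c x W1 W2 where "a = base_curv (q $ 1)" "b = mixed_curv (q $ 1)"
    "c = sphere_curv (q $ 1)" "x = weyl_curv (q $ 1)"
    "W1 = tachibana (P q) (kulkarni_nomizu (P q) (T q)) X1 X2 X3 X4 X Y"
    "W2 = tachibana (P q) (split_curvature (P q) (T q) 0 0 1) X1 X2 X3 X4 X Y"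
  note vars = this
  note geom = riemann_ibh[OF assms(1)] conformal_ibh[OF assms(1)]
    splitting.curv_dot_split_curvature ricci_ibh[OF assms(1)]
    splitting.metric_eq_split_form tach vars[symmetric]
  note t = t_pos[OF assms(1)] assms(2,3)
  \<comment> \<open>These are the premises of the coefficient equations in order: the formula for
    \<open>d\<close>, \<open>x\<close> and \<open>d\<close> nonzero, and \<open>l\<close>,
    \<open>m\<close> as the Ricci coefficients.\<close>
  note nonzero = curv_disc_def weyl_curv_nonzero[OF t] curv_disc_nonzero[OF t] refl refl
  note L = L1_curv[OF t] L2_curv[OF t] L3_curv[OF t] L4_curv[OF t(1)]
  show ?i unfolding geom using coefficients_i[OF nonzero, folded L, folded vars] by algebra
  show ?ii unfolding geom using coefficients_ii[OF nonzero, folded L, folded vars] by algebra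
  show ?iii
    unfolding geom L5_def using coefficients_iii[OF nonzero, folded L, folded vars] by algebra
qed

end

theorem proposition3p1:
  fixes \<xi> :: "real \<Rightarrow> real" and I :: "real set"
  defines "g \<equiv> ibh_metric \<xi>" and "M \<equiv> ibh_domain \<xi> I"
  assumes I: "open I" "is_interval I" "I \<subseteq> {0<..}"
    and smooth: "smooth_on I \<xi>"
    and V5: "\<forall>p\<in>M. V5 \<xi> (p $ 1) \<noteq> 0"
    and E: "\<forall>p\<in>M. E_fun \<xi> (p $ 1) \<noteq> 0"
  shows "(\<forall>p\<in>M. \<forall>X1 X2 X3 X4 X Y.
      curv_dot g p (riemann g p) (riemann g p) X1 X2 X3 X4 X Y
        - tachibana (ricci g p) (riemann g p) X1 X2 X3 X4 X Y
      = L1 \<xi> (p $ 1) * tachibana (metric_form g p) (conformal g p) X1 X2 X3 X4 X Y)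
    \<and> (\<forall>p\<in>M. \<forall>X1 X2 X3 X4 X Y.
      curv_dot g p (conformal g p) (riemann g p) X1 X2 X3 X4 X Y
        - curv_dot g p (riemann g p) (conformal g p) X1 X2 X3 X4 X Y
      = L2 \<xi> (p $ 1) * tachibana (metric_form g p) (riemann g p) X1 X2 X3 X4 X Y
        + L3 \<xi> (p $ 1) * tachibana (ricci g p) (riemann g p) X1 X2 X3 X4 X Y)
    \<and> (\<forall>p\<in>M. \<forall>X1 X2 X3 X4 X Y.
      curv_dot g p (conformal g p) (riemann g p) X1 X2 X3 X4 X Y
        - curv_dot g p (riemann g p) (conformal g p) X1 X2 X3 X4 X Y
      = L4 \<xi> (p $ 1) * tachibana (metric_form g p) (conformal g p) X1 X2 X3 X4 X Y
        + L5 \<xi> (p $ 1) * tachibana (ricci g p) (conformal g p) X1 X2 X3 X4 X Y)"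
proof -
  interpret ibh_chart \<xi> I
    using I smooth by unfold_locales
  show ?thesis
    using V5 E unfolding g_def M_def by (intro conjI ballI allI ibh_identities) auto
qed

end
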